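(* Consider instances in which each request $i\in[n]$ satisfies $s_i\in[1,M]$, $o_i\in[1,M]$ and $s_i+o_i\le M$. Then the algorithm $\mathrm{MC\text{-}SF}$ has unbounded approximation ratio: $$\mathrm{AR}(\mathrm{MC\text{-}SF})=\sup_{\mathcal I}\frac{\mathrm{TEL}(\mathrm{MC\text{-}SF};\mathcal I)}{\mathrm{TEL}(\mathrm{Optimal};\mathcal I)}\longrightarrow\infty\qquad\text{as } M\to\infty,$$ where, for each $M$, the supremum is over all such instances $\mathcal I$ with memory capacity $M$, and $\mathrm{Optimal}$ is a feasible schedule of minimum total end-to-end latency.
   Context: Model. A single worker has memory capacity $M$ (a positive integer). An instance $\mathcal I$ is a finite set of $n$ requests, all available at time $0$; request $i$ has a prefill size $s_i$ and an output length $o_i$, both positive integers. Time is discrete. A schedule $\Lambda$ assigns to each request an integer start time $p_i\ge 0$. Request $i$ then runs without interruption, generating its $j$-th output token ($j=1,\dots,o_i$) at time $p_i+j$ and using $s_i+j$ units of memory at that time, and it completes, releasing its memory, at time $c_i(\Lambda)=p_i+o_i$. The schedule is feasible if at every time $t\ge 1$, $\sum_{i:\,1\le t-p_i\le o_i}(s_i+t-p_i)\le M$. The total end-to-end latency is $\mathrm{TEL}(\Lambda;\mathcal I)=\sum_i c_i(\Lambda)$. Algorithm $\mathrm{MC\text{-}SF}$ (memory-constrained shortest-first). At each time $t=0,1,2,\dots$, let $\mathcal R^{(t)}$ be the set of requests not yet started and $\mathcal V^{(t)}$ the set of requests in progress (started before $t$ and not completed by time $t$), with start times $p_i$. Requests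 of $\mathcal R^{(t)}$ are considered in nondecreasing order of output length $o_i$ (ties broken arbitrarily) and added one by one to a set $U$, all of whose members start at time $t$, as long as the set $U$ including the new request satisfies $$\sum_{i\in\mathcal V^{(t)}}(s_i+t'-p_i)\,\mathbf 1_{\{o_i\ge t'-p_i\}}+\sum_{i\in U}(s_i+t'-t)\,\mathbf 1_{\{o_i\ge t'-t\}}\le M\qquad\text{for all } t'\in\{t,\dots,t_{\max}(U)\},$$ where $t_{\max}(U)=\max_{i\in U}\{t+o_i\}$; the process stops for time $t$ at the first request whose addition violates this condition. *)

theory Defs
  imports "HOL-Library.Extended_Real"
begin

text \<open>
  An instance is the list of the pairs \<open>(s\<^sub>i, o\<^sub>i)\<close>; requests are the indices
  \<open>i < length I\<close>, so that several requests may share the same parameters.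
  A schedule is the function of start times; its values outside the index range are irrelevant.
\<close>

type_synonym inst = "(nat \<times> nat) list"
type_synonym schedule = "nat \<Rightarrow> nat"

abbreviation requests :: "inst \<Rightarrow> nat set" where
  "requests I \<equiv> {..<length I}"

abbreviation prefill :: "inst \<Rightarrow> nat \<Rightarrow> nat" where
  "prefill I i \<equiv> fst (I ! i)"

abbreviation outlen :: "inst \<Rightarrow> nat \<Rightarrow> nat" where
  "outlen I i \<equiv> snd (I ! i)"

text \<open>The empty instance is excluded, as its latency ratio would be \<open>0 / 0\<close>.\<close>

definition instances :: "nat \<Rightarrow> inst set" where
  "instances M = {I. I \<noteq> [] \<and>
     (\<forall>i\<in>requests I. prefill I i \<in> {1..M} \<and> outlen I i \<in> {1..M}
        \<and> prefill I i + outlen I i \<le> M)}"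

definition completion :: "inst \<Rightarrow> schedule \<Rightarrow> nat \<Rightarrow> nat" where
  "completion I p i = p i + outlen I i"

text \<open>
  The index set is \<open>1 \<le> t - p\<^sub>i \<le> o\<^sub>i\<close> written without subtraction, so that the
  truncated difference of natural numbers below is the true one.
\<close>

definition feasible :: "nat \<Rightarrow> inst \<Rightarrow> schedule \<Rightarrow> bool" where
  "feasible M I p \<longleftrightarrow>
     (\<forall>t\<ge>1. (\<Sum>i | i \<in> requests I \<and> p i + 1 \<le> t \<and> t \<le> p i + outlen I i.
                prefill I i + (t - p i)) \<le> M)"

definition TEL :: "inst \<Rightarrow> schedule \<Rightarrow> nat" where
  "TEL I p = (\<Sum>i\<in>requests I. completion I p i)"

definition optimal :: "nat \<Rightarrow> inst \<Rightarrow> schedule" where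
  "optimal M I = arg_min (TEL I) (feasible M I)"

definition unstarted :: "inst \<Rightarrow> schedule \<Rightarrow> nat \<Rightarrow> nat set" where
  "unstarted I p t = {i \<in> requests I. t \<le> p i}"

definition in_progress :: "inst \<Rightarrow> schedule \<Rightarrow> nat \<Rightarrow> nat set" where
  "in_progress I p t = {i \<in> requests I. p i < t \<and> t < completion I p i}"

text \<open>The admission test of MC-SF at time \<open>t\<close>; it is only applied to nonempty \<open>U\<close>.\<close>

definition fits :: "nat \<Rightarrow> inst \<Rightarrow> schedule \<Rightarrow> nat \<Rightarrow> nat set \<Rightarrow> bool" where
  "fits M I p t U \<longleftrightarrow>
     (\<forall>t'\<in>{t..Max ((\<lambda>i. t + outlen I i) ` U)}.
        (\<Sum>i\<in>in_progress I p t.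
           (prefill I i + (t' - p i)) * of_bool (outlen I i \<ge> t' - p i))
      + (\<Sum>i\<in>U. (prefill I i + (t' - t)) * of_bool (outlen I i \<ge> t' - t)) \<le> M)"

fun greedy :: "nat \<Rightarrow> inst \<Rightarrow> schedule \<Rightarrow> nat \<Rightarrow> nat set \<Rightarrow> nat list \<Rightarrow> nat set" where
  "greedy M I p t U [] = U"
| "greedy M I p t U (r # rs) =
     (if fits M I p t (insert r U) then greedy M I p t (insert r U) rs else U)"

text \<open>
  \<open>is_MCSF M I p\<close>: the schedule \<open>p\<close> is an output of MC-SF. At every time \<open>t\<close> the
  requests started are those admitted greedily along some ordering \<open>xs\<close> of the unstarted
  requests by output length; the choice of \<open>xs\<close>, made anew at each \<open>t\<close>, is the
  arbitrary tie-breaking. The admission at time \<open>t\<close> only looks at the values of \<open>p\<close>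
  below \<open>t\<close>, so this condition determines \<open>p\<close> step by step up to ties.
\<close>

definition MCSF_step :: "nat \<Rightarrow> inst \<Rightarrow> schedule \<Rightarrow> nat \<Rightarrow> bool" where
  "MCSF_step M I p t \<longleftrightarrow>
     (\<exists>xs. distinct xs \<and> set xs = unstarted I p t \<and> sorted (map (outlen I) xs) \<and>
           {i \<in> requests I. p i = t} = greedy M I p t {} xs)"

definition is_MCSF :: "nat \<Rightarrow> inst \<Rightarrow> schedule \<Rightarrow> bool" where
  "is_MCSF M I p \<longleftrightarrow> (\<forall>t. MCSF_step M I p t)"

text \<open>
  The supremum is taken in the extended reals, so no boundedness is presupposed.
\<close>

definition approx_ratio :: "(nat \<Rightarrow> inst \<Rightarrow> schedule) \<Rightarrow> nat \<Rightarrow> ereal" where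
  "approx_ratio alg M =
     (SUP I\<in>instances M. ereal (real (TEL I (alg M I)) / real (TEL I (optimal M I))))"

text \<open>MC-SF starts every request of every admissible instance, so it has an output.\<close>

lemma greedy_cong:
  assumes "in_progress I p t = in_progress I q t" "\<And>i. i \<in> in_progress I q t \<Longrightarrow> p i = q i"
  shows "greedy M I p t U xs = greedy M I q t U xs"
proof -
  have "fits M I p t U = fits M I q t U" for U
    unfolding fits_def using assms by (simp cong: sum.cong)
  then show ?thesis by (induction xs arbitrary: U) auto
qed

lemma greedy_bounds: "U \<subseteq> greedy M I p t U xs \<and> greedy M I p t U xs \<subseteq> U \<union> set xs"
proof (induction xs arbitrary: U)
  case (Cons r rs)
  from Cons[of "insert r U"] show ?case by auto
qed simp

lemma MCSF_step_cong:
  assumes "\<And>i. i \<in> requests I \<Longrightarrow> p i = q i \<or> (t < p i \<and> t < q i)" "MCSF_step M I p t"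
  shows "MCSF_step M I q t"
proof -
  have 1: "unstarted I p t = unstarted I q t"
    unfolding unstarted_def using assms(1) by fastforce
  have 2: "in_progress I p t = in_progress I q t"
    unfolding in_progress_def completion_def using assms(1) by fastforce
  have 3: "p i = q i" if "i \<in> in_progress I q t" for i
    using that assms(1)[of i] by (auto simp: in_progress_def)
  have 4: "{i \<in> requests I. p i = t} = {i \<in> requests I. q i = t}"
    using assms(1) by fastforce
  show ?thesis
    using assms(2) unfolding MCSF_step_def 1 4 by (simp only: greedy_cong[OF 2 3])
qed

lemma MCSF_prefix: "\<exists>p. \<forall>t<T. MCSF_step M I p t"
proof (induction T)
  case (Suc T)
  then obtain p where p: "\<And>t. t < T \<Longrightarrow> MCSF_step M I p t" by blast
  define xs where "xs = sort_key (outlen I) (sorted_list_of_set (unstarted I p T))"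
  have fin: "finite (unstarted I p T)" by (simp add: unstarted_def)
  have xs: "distinct xs" "set xs = unstarted I p T" "sorted (map (outlen I) xs)"
    using fin by (simp_all add: xs_def)
  define G where "G = greedy M I p T {} xs"
  have G: "G \<subseteq> unstarted I p T" using greedy_bounds[of "{}" M I p T xs] xs by (simp add: G_def)
  define q where "q i = (if p i < T then p i else if i \<in> G then T else Suc T)" for i
  have lt: "MCSF_step M I q t" if "t < T" for t
    by (rule MCSF_step_cong[OF _ p[OF that]]) (use that in \<open>auto simp: q_def\<close>)
  have ip: "in_progress I q T = in_progress I p T"
    by (auto simp: in_progress_def completion_def q_def split: if_splits)
  have eq: "q i = p i" if "i \<in> in_progress I p T" for i
    using that by (auto simp: in_progress_def q_def)
  have "unstarted I q T = unstarted I p T"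
    by (auto simp: unstarted_def q_def split: if_splits)
  moreover have "{i \<in> requests I. q i = T} = G"
    using G by (auto simp: unstarted_def q_def split: if_splits)
  ultimately have "MCSF_step M I q T"
    unfolding MCSF_step_def using xs greedy_cong[OF ip eq] G_def by metis
  then show ?case using lt less_Suc_eq by blast
qed simp

lemma MCSF_progress:
  assumes "I \<in> instances M" "MCSF_step M I p (t + M)" "unstarted I p (t + M) \<noteq> {}"
  shows "\<exists>i\<in>requests I. t \<le> p i \<and> p i \<le> t + M"
proof (cases "in_progress I p (t + M) = {}")
  case True
  obtain xs where xs: "set xs = unstarted I p (t + M)"
    "{i \<in> requests I. p i = t + M} = greedy M I p (t + M) {} xs"
    using assms(2) by (auto simp: MCSF_step_def)
  then obtain r rs where r: "xs = r # rs" using assms(3) by (cases xs) auto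
  have "r \<in> requests I" using xs r by (auto simp: unstarted_def)
  then have "prefill I r + outlen I r \<le> M" using assms(1) by (auto simp: instances_def)
  then have "fits M I p (t + M) {r}" by (auto simp: fits_def True)
  then have "r \<in> greedy M I p (t + M) {} xs"
    using greedy_bounds[of "{r}" M I p "t + M" rs] by (auto simp: r)
  then have "r \<in> requests I \<and> p r = t + M" unfolding xs(2)[symmetric] by simp
  then show ?thesis by (intro bexI[of _ r]) simp_all
next
  case False
  then obtain i where i: "i \<in> requests I" "p i < t + M" "t + M < p i + outlen I i"
    by (auto simp: in_progress_def completion_def)
  then have "outlen I i \<le> M" using assms(1) by (auto simp: instances_def)
  then have "t \<le> p i \<and> p i \<le> t + M" using i by linarith
  then show ?thesis using i by blast
qed

lemma MCSF_exists:
  assumes "I \<in> instances M"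
  shows "\<exists>p. is_MCSF M I p"
proof -
  let ?K = "Suc M" and ?n = "length I"
  obtain p where p: "\<And>t. t < ?n * ?K \<Longrightarrow> MCSF_step M I p t"
    using MCSF_prefix by blast
  have "card (unstarted I p (k * ?K)) \<le> ?n - k" if "k \<le> ?n" for k
    using that
  proof (induction k)
    case 0
    have "card (unstarted I p 0) \<le> card (requests I)"
      by (rule card_mono) (auto simp: unstarted_def)
    then show ?case by simp
  next
    case (Suc k)
    let ?t = "k * ?K"
    have sub: "unstarted I p (Suc k * ?K) \<subseteq> unstarted I p (?t + M)"
      by (auto simp: unstarted_def)
    show ?case
    proof (cases "unstarted I p (?t + M) = {}")
      case True
      then show ?thesis using sub by simp
    next
      case False
      have "Suc k * ?K \<le> ?n * ?K" using Suc.prems mult_le_mono1 by blast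
      then have "?t + M < ?n * ?K" by simp
      from MCSF_progress[OF assms p[OF this] False]
      obtain i where i: "i \<in> requests I" "?t \<le> p i" "p i \<le> ?t + M" by blast
      have "i \<in> unstarted I p ?t" "i \<notin> unstarted I p (Suc k * ?K)"
        using i by (simp_all add: unstarted_def)
      moreover have "unstarted I p (Suc k * ?K) \<subseteq> unstarted I p ?t"
        by (auto simp: unstarted_def)
      ultimately have "unstarted I p (Suc k * ?K) \<subset> unstarted I p ?t" by blast
      moreover have "finite (unstarted I p ?t)" by (simp add: unstarted_def)
      ultimately have "card (unstarted I p (Suc k * ?K)) < card (unstarted I p ?t)"
        by (metis psubset_card_mono)
      then show ?thesis using Suc by linarith
    qed
  qed
  from this[of ?n] have "unstarted I p (?n * ?K) = {}" by (simp add: unstarted_def)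
  then have all: "p i < ?n * ?K" if "i \<in> requests I" for i
    using that by (auto simp: unstarted_def not_le)
  have "MCSF_step M I p t" if "\<not> t < ?n * ?K" for t
  proof -
    have "unstarted I p t = {}" "{i \<in> requests I. p i = t} = {}"
      using all that by (force simp: unstarted_def)+
    then show ?thesis unfolding MCSF_step_def by (intro exI[of _ "[]"]) simp
  qed
  then show ?thesis using p unfolding is_MCSF_def by blast
qed

lemma feasible_exists:
  assumes "I \<in> instances M"
  shows "\<exists>p. feasible M I p"
proof -
  define p where "p i = i * M" for i
  have "feasible M I p" unfolding feasible_def
  proof (intro allI impI)
    fix t :: nat assume "1 \<le> t"
    let ?A = "{i. i \<in> requests I \<and> p i + 1 \<le> t \<and> t \<le> p i + outlen I i}"
    have le: "outlen I i \<le> M" "prefill I i + outlen I i \<le> M" if "i \<in> requests I" for i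
      using assms that by (auto simp: instances_def)
    have uniq: "\<not> i < j" if "i \<in> ?A" "j \<in> ?A" for i j
    proof
      assume "i < j"
      then have "Suc i * M \<le> j * M" using Suc_leI mult_le_mono1 by blast
      then show False using that le(1)[of i] by (auto simp: p_def)
    qed
    show "(\<Sum>i\<in>?A. prefill I i + (t - p i)) \<le> M"
    proof (cases "?A = {}")
      case False
      then obtain i where i: "i \<in> ?A" by blast
      have "j = i" if "j \<in> ?A" for j
        using uniq[OF i that] uniq[OF that i] by simp
      then have "?A = {i}" using i by blast
      moreover have "prefill I i + (t - p i) \<le> M" using i le(2)[of i] by auto
      ultimately show ?thesis by simp
    next
      case True
      then show ?thesis by (metis (no_types, lifting) sum.empty zero_le)
    qed
  qed
  then show ?thesis by blast
qed

end

theory Submission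
  imports Defs
begin

text \<open>
  MC-SF orders requests by output length alone and ignores the prefill sizes, so a few requests
  that fill the whole memory for a short time can hold up many requests that need almost none.
  Take \<open>n\<close> requests with parameters \<open>(M - 1, 1)\<close> and \<open>m\<close> requests with parameters \<open>(1, 2)\<close>. A
  request of the first kind uses all \<open>M\<close> units while it runs, hence runs alone, and has the
  smaller output length. So MC-SF serves the first kind one at a time during the first \<open>n\<close> time
  steps and starts none of the second kind before time \<open>n\<close> (\<open>MCSF_delays_small\<close>); its latency is
  at least \<open>m * n\<close>.

  If \<open>3 * m \<le> M\<close>, all requests of the second kind fit into memory together. Running them as one
  batch at time \<open>0\<close> postpones each request of the first kind by only two steps, so this schedule
  has latency at most \<open>2 * m + n * (n + 2)\<close> (\<open>TEL_small_first\<close>). The choice \<open>m = n\<^sup>2\<close> makes both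
  terms of order \<open>n\<^sup>2\<close> while MC-SF pays at least \<open>n\<^sup>3\<close>. The ratio is therefore at least \<open>n / 5\<close> as
  soon as \<open>3 * n\<^sup>2 \<le> M\<close>, that is, it grows at least like \<open>sqrt M\<close>.
\<close>

definition blocking_inst :: "nat \<Rightarrow> nat \<Rightarrow> nat \<Rightarrow> inst" where
  "blocking_inst M n m = replicate n (M - 1, 1) @ replicate m (1, 2)"

definition small_first :: "nat \<Rightarrow> schedule" where
  "small_first n i = (if i < n then i + 2 else 0)"

lemma length_blocking_inst [simp]: "length (blocking_inst M n m) = n + m"
  by (simp add: blocking_inst_def)

lemma nth_blocking_inst:
  "i < n + m \<Longrightarrow> blocking_inst M n m ! i = (if i < n then (M - 1, 1) else (1, 2))"
  by (auto simp: blocking_inst_def nth_append)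

lemma blocking_inst_in_instances:
  assumes "3 \<le> M" "0 < n + m"
  shows "blocking_inst M n m \<in> instances M"
proof -
  have "blocking_inst M n m \<noteq> []"
    using assms(2) by (metis length_blocking_inst length_greater_0_conv)
  then show ?thesis using assms(1) by (auto simp: instances_def nth_blocking_inst)
qed

text \<open>
  The admission test looks at memory at time \<open>t + 1\<close>: there the request \<open>r\<close> alone uses
  \<open>M\<close>, and every further member of \<open>U\<close> still runs and needs at least one unit.
\<close>

lemma not_fits_beside_full_request:
  assumes "prefill I r + 1 = M" "1 \<le> outlen I r" "1 \<le> outlen I r'" "r \<noteq> r'"
  shows "\<not> fits M I p t (insert r' {r})"
proof
  assume "fits M I p t (insert r' {r})"
  moreover have "t + 1 \<in> {t..Max ((\<lambda>i. t + outlen I i) ` insert r' {r})}"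
    using assms(2) by simp
  ultimately have "(\<Sum>i\<in>insert r' {r}. (prefill I i + (t + 1 - t)) *
      of_bool (outlen I i \<ge> t + 1 - t)) \<le> M"
    unfolding fits_def by (meson add_leD2)
  then show False using assms by simp
qed

text \<open>
  A full request has output length \<open>1\<close>, so it is gone after one step and the next step finds
  the memory empty again. This makes the first \<open>n\<close> steps alike.
\<close>

lemma MCSF_serves_full_one_by_one:
  assumes M: "3 \<le> M" and mcsf: "is_MCSF M (blocking_inst M n m) p" and "t < n"
  shows "\<exists>r<n. {i \<in> requests (blocking_inst M n m). p i = t} = {r}"
  using \<open>t < n\<close>
proof (induction t rule: less_induct)
  case (less t)
  let ?I = "blocking_inst M n m"
  have IH: "\<exists>r<n. {i \<in> requests ?I. p i = t'} = {r}" if "t' < t" for t'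
    using less that by simp
  have started_full: "i < n" if "i \<in> requests ?I" "p i < t" for i
  proof -
    from IH[OF that(2)] obtain r where "r < n" and r: "{j \<in> requests ?I. p j = p i} = {r}"
      by blast
    have "i \<in> {j \<in> requests ?I. p j = p i}" using that(1) by simp
    then show ?thesis using \<open>r < n\<close> unfolding r by simp
  qed
  have idle: "in_progress ?I p t = {}"
  proof -
    have False if "i \<in> in_progress ?I p t" for i
    proof -
      have "i \<in> requests ?I" "p i < t" "t < p i + outlen ?I i"
        using that by (auto simp: in_progress_def completion_def)
      then show False using started_full[of i] by (simp add: nth_blocking_inst)
    qed
    then show ?thesis by blast
  qed
  \<comment> \<open>Only \<open>t < n\<close> requests have started so far, so a full one is still waiting.\<close>
  obtain i where i: "i < n" "t \<le> p i"
  proof -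
    have "{i \<in> requests ?I. p i < t} = (\<Union>t'<t. {i \<in> requests ?I. p i = t'})" by auto
    also have "card \<dots> \<le> (\<Sum>t'<t. card {i \<in> requests ?I. p i = t'})"
      by (rule card_UN_le) simp
    also have "\<dots> = (\<Sum>t'<t. 1)"
    proof (rule sum.cong)
      fix t' assume "t' \<in> {..<t}"
      then obtain r where "{i \<in> requests ?I. p i = t'} = {r}" using IH by blast
      then show "card {i \<in> requests ?I. p i = t'} = 1" by (metis card_1_singleton_iff One_nat_def)
    qed simp
    also have "\<dots> < card {..<n}" using less.prems by simp
    finally have "\<not> {..<n} \<subseteq> {i \<in> requests ?I. p i < t}"
      using card_mono[of "{i \<in> requests ?I. p i < t}" "{..<n}"] by fastforce
    then obtain j where "j < n" "\<not> p j < t" by auto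
    then show ?thesis using that[of j] by simp
  qed
  have "MCSF_step M ?I p t" using mcsf by (simp add: is_MCSF_def)
  then obtain xs where xs: "distinct xs" "set xs = unstarted ?I p t"
      "sorted (map (outlen ?I) xs)" "{i \<in> requests ?I. p i = t} = greedy M ?I p t {} xs"
    unfolding MCSF_step_def by blast
  have "i \<in> set xs" using i by (simp add: xs(2) unstarted_def)
  then obtain r rs where r: "xs = r # rs" by (cases xs) auto
  have len: "j < n + m" if "j \<in> set xs" for j
    using that xs(2) by (auto simp: unstarted_def)
  \<comment> \<open>The sorted order puts a full request first, as one is waiting.\<close>
  have "outlen ?I r \<le> outlen ?I i" using \<open>i \<in> set xs\<close> xs(3) r by auto
  then have "r < n"
    using i len[of r] by (auto simp: r nth_blocking_inst split: if_splits)
  then have nth_r: "?I ! r = (M - 1, 1)" by (simp add: nth_blocking_inst)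
  have fits_r: "fits M ?I p t {r}"
    using M by (auto simp: fits_def idle nth_r)
  have "greedy M ?I p t {} xs = {r}"
  proof (cases rs)
    case Nil
    then show ?thesis using fits_r by (simp add: r)
  next
    case (Cons r' rs')
    have "r \<noteq> r'" using xs(1) by (auto simp: r Cons)
    moreover have "1 \<le> outlen ?I r'" using len[of r'] by (simp add: r Cons nth_blocking_inst)
    ultimately have "\<not> fits M ?I p t {r', r}"
      using not_fits_beside_full_request[of ?I r M r' p t] M nth_r by simp
    then show ?thesis using fits_r by (simp add: r Cons)
  qed
  then show ?case using \<open>r < n\<close> xs(4) by auto
qed

lemma MCSF_delays_small:
  assumes "3 \<le> M" "is_MCSF M (blocking_inst M n m) p" "n \<le> i" "i < n + m"
  shows "n \<le> p i"
proof (rule ccontr)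
  assume "\<not> n \<le> p i"
  then obtain r where "r < n" and r: "{j \<in> requests (blocking_inst M n m). p j = p i} = {r}"
    using MCSF_serves_full_one_by_one[OF assms(1,2), of "p i"] by auto
  have "i \<in> {j \<in> requests (blocking_inst M n m). p j = p i}" using assms(4) by simp
  then show False using \<open>r < n\<close> assms(3) unfolding r by simp
qed

lemma TEL_MCSF_blocking_ge:
  assumes "3 \<le> M" "is_MCSF M (blocking_inst M n m) p"
  shows "m * n \<le> TEL (blocking_inst M n m) p"
proof -
  let ?I = "blocking_inst M n m"
  have "m * n = (\<Sum>i\<in>{n..<n + m}. n)" by simp
  also have "\<dots> \<le> (\<Sum>i\<in>{n..<n + m}. completion ?I p i)"
    by (rule sum_mono) (use MCSF_delays_small[OF assms] in \<open>simp add: completion_def trans_le_add1\<close>)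
  also have "\<dots> \<le> TEL ?I p"
    unfolding TEL_def by (rule sum_mono2) auto
  finally show ?thesis .
qed

text \<open>
  The small batch runs at times \<open>1\<close> and \<open>2\<close> with at most three units per request; from time \<open>3\<close> on
  at most one request is in memory, a full one.
\<close>

lemma feasible_small_first:
  assumes "1 \<le> M" "3 * m \<le> M"
  shows "feasible M (blocking_inst M n m) (small_first n)"
  unfolding feasible_def
proof (intro allI impI)
  fix t :: nat assume "1 \<le> t"
  let ?I = "blocking_inst M n m" and ?p = "small_first n"
  let ?A = "{i. i \<in> requests ?I \<and> ?p i + 1 \<le> t \<and> t \<le> ?p i + outlen ?I i}"
  let ?f = "\<lambda>i. prefill ?I i + (t - ?p i)"
  show "sum ?f ?A \<le> M"
  proof (cases "t \<le> 2")
    case True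
    have small: "n \<le> i \<and> i < n + m" if "i \<in> ?A" for i
      using that True by (auto simp: small_first_def split: if_splits)
    then have "?f i \<le> 3" if "i \<in> ?A" for i
      using that True by (force simp: small_first_def nth_blocking_inst)
    then have "sum ?f ?A \<le> card ?A * 3"
      using sum_bounded_above[of ?A ?f 3] by simp
    also have "card ?A \<le> card {n..<n + m}"
      by (rule card_mono) (use small in auto)
    finally show ?thesis using assms(2) by simp
  next
    case False
    have full: "i < n \<and> i = t - 3" if "i \<in> ?A" for i
      using that False by (auto simp: small_first_def nth_blocking_inst split: if_splits)
    have "?f i \<le> M" if "i \<in> ?A" for i
      using full[OF that] False assms(1) by (simp add: small_first_def nth_blocking_inst)
    then have "sum ?f ?A \<le> card ?A * M"
      using sum_bounded_above[of ?A ?f M] by simp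
    also have "card ?A \<le> card {t - 3}"
      by (rule card_mono) (use full in auto)
    finally show ?thesis by simp
  qed
qed

lemma TEL_small_first:
  "TEL (blocking_inst M n m) (small_first n) \<le> 2 * m + n * (n + 2)"
proof -
  let ?c = "completion (blocking_inst M n m) (small_first n)"
  have "TEL (blocking_inst M n m) (small_first n) = sum ?c {..<n} + sum ?c {n..<n + m}"
    unfolding TEL_def by (subst sum.union_disjoint[symmetric]) (auto intro: sum.cong)
  also have "sum ?c {..<n} \<le> (\<Sum>i<n. n + 2)"
    by (rule sum_mono) (simp add: completion_def small_first_def nth_blocking_inst)
  also have "sum ?c {n..<n + m} = (\<Sum>i\<in>{n..<n + m}. 2)"
    by (rule sum.cong) (simp_all add: completion_def small_first_def nth_blocking_inst)
  finally show ?thesis by simp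
qed

lemma TEL_optimal_le: "feasible M I p \<Longrightarrow> TEL I (optimal M I) \<le> TEL I p"
  unfolding optimal_def by (rule arg_min_nat_le[where P = "feasible M I"])

text \<open>Positivity keeps latency ratios away from the default value of division by \<open>0\<close>.\<close>

lemma TEL_pos:
  assumes "I \<in> instances M"
  shows "0 < TEL I p"
proof -
  have "0 \<in> requests I" "1 \<le> outlen I 0" using assms by (auto simp: instances_def)
  then have "0 < completion I p 0" by (simp add: completion_def)
  also have "\<dots> \<le> TEL I p"
    unfolding TEL_def by (rule member_le_sum) (use \<open>0 \<in> requests I\<close> in auto)
  finally show ?thesis .
qed

lemma approx_ratio_MCSF_ge:
  fixes alg :: "nat \<Rightarrow> inst \<Rightarrow> schedule"
  assumes alg: "\<And>I. I \<in> instances M \<Longrightarrow> is_MCSF M I (alg M I)"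
    and n: "1 \<le> n" and M: "3 * n\<^sup>2 \<le> M"
  shows "ereal (real n / 5) \<le> approx_ratio alg M"
proof -
  define I where "I = blocking_inst M n (n\<^sup>2)"
  have "1 \<le> n\<^sup>2" using n by simp
  then have M3: "3 \<le> M" using M by linarith
  have I: "I \<in> instances M" unfolding I_def using M3 n by (intro blocking_inst_in_instances) auto
  have A: "n\<^sup>2 * n \<le> TEL I (alg M I)"
    using TEL_MCSF_blocking_ge[OF M3] alg[OF I] unfolding I_def by blast
  have "TEL I (optimal M I) \<le> TEL I (small_first n)"
    unfolding I_def by (rule TEL_optimal_le, rule feasible_small_first) (use M3 M in auto)
  also have "\<dots> \<le> 2 * n\<^sup>2 + n * (n + 2)"
    unfolding I_def by (rule TEL_small_first)
  also have "\<dots> \<le> 5 * n\<^sup>2"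
    using n by (simp add: power2_eq_square algebra_simps)
  finally have B: "TEL I (optimal M I) \<le> 5 * n\<^sup>2" .
  have "n * TEL I (optimal M I) \<le> n * (5 * n\<^sup>2)" using B by (rule mult_le_mono2)
  also have "\<dots> \<le> 5 * TEL I (alg M I)" using A by (simp add: algebra_simps)
  finally have "real n * real (TEL I (optimal M I)) \<le> 5 * real (TEL I (alg M I))"
    by (metis of_nat_le_iff of_nat_mult of_nat_numeral)
  then have "real n / 5 \<le> real (TEL I (alg M I)) / real (TEL I (optimal M I))"
    using TEL_pos[OF I] by (simp add: field_simps)
  then show ?thesis
    unfolding approx_ratio_def by (intro SUP_upper2[OF I]) simp
qed

theorem theorem1:
  fixes mcsf :: "nat \<Rightarrow> inst \<Rightarrow> schedule"
  assumes "\<And>M I. I \<in> instances M \<Longrightarrow> is_MCSF M I (mcsf M I)"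
  shows "(\<lambda>M. approx_ratio mcsf M) \<longlonglongrightarrow> \<infinity>"
  unfolding tendsto_PInfty
proof
  fix r :: real
  obtain k :: nat where "5 * r < real k" using reals_Archimedean2 by blast
  then have k: "ereal r < ereal (real (Suc k) / 5)" by simp
  show "\<forall>\<^sub>F M in sequentially. ereal r < approx_ratio mcsf M"
  proof (rule eventually_sequentiallyI[of "3 * (Suc k)\<^sup>2"])
    fix M assume "3 * (Suc k)\<^sup>2 \<le> M"
    then have "ereal (real (Suc k) / 5) \<le> approx_ratio mcsf M"
      by (intro approx_ratio_MCSF_ge assms) auto
    with k show "ereal r < approx_ratio mcsf M" by (rule less_le_trans)
  qed
qed

end
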